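(* Let $S_1=(X_1,X_1,U_1,U_1,X_1,F_1,\mathrm{id})$ be a simple system with $F_1$ strict; let $P_1\colon\hat U_1\rightrightarrows U_1$, $P_2\colon X_1\rightrightarrows\hat X_1$, $P_3\colon\hat U_1\rightrightarrows Y_1$, $P_4\colon X_1\rightrightarrows Y_2$ be strict set-valued maps with nonempty domains (perturbation maps); let $Q\colon\hat X_1\rightrightarrows X_2$ be a strict set-valued map (quantizer); and let $C=(X_c,X_{c,0},X_2,V_c,\hat U_1,F_c,H_c)$ be a system (controller). Let $\Sigma_1$ be a specification on $Y_1\times Y_2$. Let $\hat S_1=(X_1,X_1,\hat U_1,\hat U_1,X_1,\hat F_1,\mathrm{id})$ be the simple system with $\hat F_1(x,u)=F_1(x,P_1(u))$, let $\hat\Sigma_1$ be a specification on $\hat U_1\times X_1$ that is a robust specification of $\Sigma_1$ with respect to $P_3$ and $P_4$, and let $\hat Q=Q\circ P_2$. If $C$ solves a control problem $(S_2,\Sigma_2)$ with $(\hat S_1,\hat\Sigma_1)\preccurlyeq_{\hat Q}(S_2,\Sigma_2)$, where $S_2$ is a simple system with state alphabet $X_2$, then the behavior of the perturbed closed loop formed by $S_1$, $P_1,\dots,P_4$, $Q$ and $C$ is a subset of $\Sigma_1$.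
   Context: Notation. $\mathbb{N}=\{1,2,\dots\}$, $\mathbb{Z}_+=\{0,1,2,\dots\}$. For $T\in\mathbb{Z}_+\cup\{\infty\}$, $[0;T[\,=\{t\in\mathbb{Z}_+: t<T\}$; $A^{[0;T[}$ is the set of maps $[0;T[\,\to A$, and $A^\infty=\bigcup_{T\in\mathbb{Z}_+\cup\{\infty\}}A^{[0;T[}$. $f\colon A\rightrightarrows B$ denotes a set-valued map, identified with the relation $\{(a,b): b\in f(a)\}\subseteq A\times B$; $f(M)=\bigcup_{a\in M}f(a)$ for $M\subseteq A$; $f$ is strict if $f(a)\neq\emptyset$ for all $a\in A$; $(f\circ g)(x)=f(g(x))$; $F_1(x,M)=\bigcup_{u\in M}F_1(x,u)$. Systems. A system is a septuple $S=(X,X_0,U,V,Y,F,H)$ where $X,X_0,U,V,Y$ are nonempty sets (state, initial state, input, internal variable and output alphabet), $X_0\subseteq X$, $H\colon X\times U\rightrightarrows Y\times V$ is strict, and $F\colon X\times V\rightrightarrows X$. A solution of $S$ on $[0;T[$, $T\in\mathbb{N}\cup\{\infty\}$, is a quadruple $(u,v,x,y)\in U^{[0;T[}\times V^{[0;T[}\times X^{[0;T[}\times Y^{[0;T[}$ with $x(0)\in X_0$, $x(t+1)\in F(x(t),v(t))$ for all $t\in[0;T-1[$, and $(y(t),v(t))\in H(x(t),u(t))$ for all $t\in[0;T[$. $S$ is Moore if $(y,v)\in H(x,u)$ and $u'\in U$ imply that there is $v'$ with $(y,v')\in H(x,u')$. $S$ is simple if $U=V$, $X=Y$, $X_0=X$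 and $H=\mathrm{id}$, i.e. $H(x,u)=\{(x,u)\}$. Behavior. $\mathcal{B}(S)$ is the set of pairs $(u,y)$ for which there exist $v,x,T$ such that $(u,v,x,y)$ is a solution of $S$ on $[0;T[$ and, if $T<\infty$, then $F(x(T-1),v(T-1))=\emptyset$. Feedback composition. Let $S_i=(X_i,X_{i,0},U_i,V_i,Y_i,F_i,H_i)$, $i\in\{1,2\}$, be systems. $S_1$ is feedback composable with $S_2$ if $S_2$ is Moore, $Y_2\subseteq U_1$, $Y_1\subseteq U_2$, and: whenever $(y_2,v_2)\in H_2(x_2,y_1)$, $(y_1,v_1)\in H_1(x_1,y_2)$ and $F_2(x_2,v_2)=\emptyset$, then $F_1(x_1,v_1)=\emptyset$. In that case the closed loop is $S_1\times S_2=(X_1\times X_2,X_{1,0}\times X_{2,0},\{0\},V_1\times V_2,Y_1\times Y_2,F_{12},H_{12})$ with $F_{12}(x,v)=F_1(x_1,v_1)\times F_2(x_2,v_2)$ and $H_{12}(x,0)=\{(y,v): (y_1,v_1)\in H_1(x_1,y_2)\wedge(y_2,v_2)\in H_2(x_2,y_1)\}$. Elements $(0,(y_1,y_2))$ of the behavior of $S_1\times S_2$ are identified with $(y_1,y_2)$. Control problems. A specification on a set $Z$ is a subset $\Sigma\subseteq Z^\infty$ (pairs of maps with common domain are identified with maps into the product). Given a system $S$ with input alphabet $U$ and output alphabet $Y$ and a specification $\Sigma$ on $U\times Y$, a system $C$ solves the control problem $(S,\Sigma)$ if $C$ is feedback composable with $S$ and $\mathcal{B}(C\times S)\subseteq\Sigma$.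 Perturbed closed loop. The behavior of the perturbed closed loop formed by $S_1,P_1,\dots,P_4,Q,C$ is the set of all $(y_1,y_2)\in(Y_1\times Y_2)^{[0;T[}$, $T\in\mathbb{N}\cup\{\infty\}$, for which there exist a solution $(u,u,x,x)$ of $S_1$ on $[0;T[$ and a solution $(u_c,v_c,x_c,y_c)$ of $C$ on $[0;T[$ such that: (1) for all $t\in[0;T[$: $u(t)\in P_1(y_c(t))$, $u_c(t)\in Q(P_2(x(t)))$, $y_1(t)\in P_3(y_c(t))$, $y_2(t)\in P_4(x(t))$; (2) if $T<\infty$, then $F_1(x(T-1),u(T-1))=\emptyset$ or $F_c(x_c(T-1),v_c(T-1))=\emptyset$. Robust specification. For specifications $\Sigma_1$ on $Y_1\times Y_2$ and $\hat\Sigma_1$ on $\hat U_1\times X_1$, $\hat\Sigma_1$ is a robust specification of $\Sigma_1$ with respect to $P_3$ and $P_4$ if for all $T\in\mathbb{N}\cup\{\infty\}$ and all $(y_c,x,y_1,y_2)\in(\hat U_1\times X_1\times Y_1\times Y_2)^{[0;T[}$: if $(y_c,x)\in\hat\Sigma_1$ and $y_1(t)\in P_3(y_c(t))$, $y_2(t)\in P_4(x(t))$ for all $t\in[0;T[$, then $(y_1,y_2)\in\Sigma_1$. Feedback refinement relation. For a simple system $S$ put $U_S(x)=\{u\in U: F(x,u)\neq\emptyset\}$. For simple systems $S_i=(X_i,X_i,U_i,U_i,X_i,F_i,\mathrm{id})$, $i\in\{1,2\}$, with $U_2\subseteq U_1$, a strict relation $R\subseteq X_1\times X_2$ is a feedback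 refinement relation from $S_1$ to $S_2$, written $S_1\preccurlyeq_R S_2$, if for all $(x_1,x_2)\in R$: (1) $U_{S_2}(x_2)\subseteq U_{S_1}(x_1)$; (2) $u\in U_{S_2}(x_2)$ implies $R(F_1(x_1,u))\subseteq F_2(x_2,u)$. Abstract specification. Let $S_1,S_2$ be simple systems as in the previous paragraph, $\Sigma_1$ a specification on $U_1\times X_1$, and $R\subseteq X_1\times X_2$ strict. A specification $\Sigma_2$ on $U_2\times X_2$ is an abstract specification associated with $S_1,S_2,R,\Sigma_1$ if: whenever $(u,x_2)\in\Sigma_2$ is defined on $[0;T[$ for some $T\in\mathbb{N}\cup\{\infty\}$, and $x_1\colon[0;T[\,\to X_1$ satisfies $(x_1(t),x_2(t))\in R$ for all $t\in[0;T[$, then $(u,x_1)\in\Sigma_1$. We write $(S_1,\Sigma_1)\preccurlyeq_R(S_2,\Sigma_2)$ if $S_1\preccurlyeq_R S_2$ and $\Sigma_2$ is an abstract specification associated with $S_1,S_2,R,\Sigma_1$. *)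

theory Defs
  imports Main "HOL-Library.Extended_Nat"
begin

text \<open>
  Set-valued maps from \<open>A\<close> to \<open>B\<close> are identified with relations \<open>f \<subseteq> A \<times> B\<close>, so that
  \<open>f(a) = f `` {a}\<close>, \<open>f(M) = f `` M\<close>, and the composition \<open>Q \<circ> P\<close> is \<open>P O Q\<close>.
\<close>

definition set_valued :: "'a set \<Rightarrow> 'b set \<Rightarrow> ('a \<times> 'b) set \<Rightarrow> bool" where
  "set_valued A B f \<longleftrightarrow> f \<subseteq> A \<times> B"

definition strict_on :: "'a set \<Rightarrow> ('a \<times> 'b) set \<Rightarrow> bool" where
  "strict_on A f \<longleftrightarrow> (\<forall>a\<in>A. f `` {a} \<noteq> {})"

text \<open>
  A map \<open>[0;T[ \<rightarrow> A\<close> is a partial map on \<open>nat\<close> whose domain is exactly \<open>[0;T[\<close>; hence \<open>T\<close> is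
  determined by the map, and its value at \<open>t\<close> is \<open>the (f t)\<close>.
\<close>

definition interval :: "enat \<Rightarrow> nat set" where
  "interval T = {t. enat t < T}"

definition signals :: "enat \<Rightarrow> 'a set \<Rightarrow> (nat \<rightharpoonup> 'a) set" where
  "signals T A = {f. dom f = interval T \<and> ran f \<subseteq> A}"

text \<open>Identification of a pair of maps (with common domain) with a map into the product.\<close>

definition pair_signal :: "(nat \<rightharpoonup> 'a) \<Rightarrow> (nat \<rightharpoonup> 'b) \<Rightarrow> (nat \<rightharpoonup> 'a \<times> 'b)" where
  "pair_signal f g =
     (\<lambda>t. case (f t, g t) of (Some a, Some b) \<Rightarrow> Some (a, b) | _ \<Rightarrow> None)"

definition is_spec :: "'a set \<Rightarrow> (nat \<rightharpoonup> 'a) set \<Rightarrow> bool" where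
  "is_spec Z \<Sigma> \<longleftrightarrow> \<Sigma> \<subseteq> (\<Union>T. signals T Z)"

record ('x, 'u, 'v, 'y) sys =
  states :: "'x set"
  inits :: "'x set"
  inputs :: "'u set"
  internals :: "'v set"
  outputs :: "'y set"
  trans_map :: "(('x \<times> 'v) \<times> 'x) set"
  out_map :: "(('x \<times> 'u) \<times> ('y \<times> 'v)) set"

definition system :: "('x, 'u, 'v, 'y) sys \<Rightarrow> bool" where
  "system S \<longleftrightarrow>
     states S \<noteq> {} \<and> inits S \<noteq> {} \<and> inputs S \<noteq> {} \<and> internals S \<noteq> {} \<and> outputs S \<noteq> {} \<and>
     inits S \<subseteq> states S \<and>
     set_valued (states S \<times> inputs S) (outputs S \<times> internals S) (out_map S) \<and>
     strict_on (states S \<times> inputs S) (out_map S) \<and>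
     set_valued (states S \<times> internals S) (states S) (trans_map S)"

definition solution ::
  "('x, 'u, 'v, 'y) sys \<Rightarrow> enat \<Rightarrow>
     (nat \<rightharpoonup> 'u) \<Rightarrow> (nat \<rightharpoonup> 'v) \<Rightarrow> (nat \<rightharpoonup> 'x) \<Rightarrow> (nat \<rightharpoonup> 'y) \<Rightarrow> bool" where
  "solution S T u v x y \<longleftrightarrow>
     1 \<le> T \<and>
     u \<in> signals T (inputs S) \<and> v \<in> signals T (internals S) \<and>
     x \<in> signals T (states S) \<and> y \<in> signals T (outputs S) \<and>
     the (x 0) \<in> inits S \<and>
     (\<forall>t\<in>interval (T - 1). the (x (t + 1)) \<in> trans_map S `` {(the (x t), the (v t))}) \<and>
     (\<forall>t\<in>interval T. (the (y t), the (v t)) \<in> out_map S `` {(the (x t), the (u t))})"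

definition moore :: "('x, 'u, 'v, 'y) sys \<Rightarrow> bool" where
  "moore S \<longleftrightarrow>
     (\<forall>x\<in>states S. \<forall>u\<in>inputs S. \<forall>u'\<in>inputs S. \<forall>y v.
        (y, v) \<in> out_map S `` {(x, u)} \<longrightarrow> (\<exists>v'. (y, v') \<in> out_map S `` {(x, u')}))"

definition simple_system :: "('x, 'u, 'u, 'x) sys \<Rightarrow> bool" where
  "simple_system S \<longleftrightarrow>
     system S \<and> inputs S = internals S \<and> states S = outputs S \<and> inits S = states S \<and>
     out_map S = Id_on (states S \<times> inputs S)"

definition behavior :: "('x, 'u, 'v, 'y) sys \<Rightarrow> ((nat \<rightharpoonup> 'u) \<times> (nat \<rightharpoonup> 'y)) set" where
  "behavior S =
     {(u, y). \<exists>v x T. solution S T u v x y \<and>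
        (\<forall>n. T = enat n \<longrightarrow> trans_map S `` {(the (x (n - 1)), the (v (n - 1)))} = {})}"

definition feedback_composable ::
  "('x1, 'y2, 'v1, 'y1) sys \<Rightarrow> ('x2, 'y1, 'v2, 'y2) sys \<Rightarrow> bool" where
  "feedback_composable S1 S2 \<longleftrightarrow>
     moore S2 \<and> outputs S2 \<subseteq> inputs S1 \<and> outputs S1 \<subseteq> inputs S2 \<and>
     (\<forall>x1 x2 y1 y2 v1 v2.
        (y2, v2) \<in> out_map S2 `` {(x2, y1)} \<and> (y1, v1) \<in> out_map S1 `` {(x1, y2)} \<and>
        trans_map S2 `` {(x2, v2)} = {} \<longrightarrow> trans_map S1 `` {(x1, v1)} = {})"

definition closed_loop ::
  "('x1, 'y2, 'v1, 'y1) sys \<Rightarrow> ('x2, 'y1, 'v2, 'y2) sys \<Rightarrow>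
     ('x1 \<times> 'x2, nat, 'v1 \<times> 'v2, 'y1 \<times> 'y2) sys" where
  "closed_loop S1 S2 =
     \<lparr> states = states S1 \<times> states S2,
       inits = inits S1 \<times> inits S2,
       inputs = {0},
       internals = internals S1 \<times> internals S2,
       outputs = outputs S1 \<times> outputs S2,
       trans_map = {(((x1, x2), (v1, v2)), (x1', x2')) | x1 x2 v1 v2 x1' x2'.
          x1' \<in> trans_map S1 `` {(x1, v1)} \<and> x2' \<in> trans_map S2 `` {(x2, v2)}},
       out_map = {(((x1, x2), 0), ((y1, y2), (v1, v2))) | x1 x2 y1 y2 v1 v2.
          (y1, v1) \<in> out_map S1 `` {(x1, y2)} \<and> (y2, v2) \<in> out_map S2 `` {(x2, y1)}} \<rparr>"

text \<open>
  The input signal of a closed loop is constantly \<open>0\<close>, so elements \<open>(0, y)\<close> of its behavior are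
  identified with \<open>y\<close>.
\<close>

definition closed_loop_behavior ::
  "('x1, 'y2, 'v1, 'y1) sys \<Rightarrow> ('x2, 'y1, 'v2, 'y2) sys \<Rightarrow> (nat \<rightharpoonup> 'y1 \<times> 'y2) set" where
  "closed_loop_behavior S1 S2 = snd ` behavior (closed_loop S1 S2)"

definition solves ::
  "('xc, 'y, 'vc, 'u) sys \<Rightarrow> ('x, 'u, 'v, 'y) sys \<Rightarrow> (nat \<rightharpoonup> 'u \<times> 'y) set \<Rightarrow> bool" where
  "solves C S \<Sigma> \<longleftrightarrow> feedback_composable C S \<and> closed_loop_behavior C S \<subseteq> \<Sigma>"

definition perturbation_map :: "'a set \<Rightarrow> 'b set \<Rightarrow> ('a \<times> 'b) set \<Rightarrow> bool" where
  "perturbation_map A B P \<longleftrightarrow> A \<noteq> {} \<and> set_valued A B P \<and> strict_on A P"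

definition perturbed_loop_behavior ::
  "'y1 set \<Rightarrow> 'y2 set \<Rightarrow> ('x, 'u, 'u, 'x) sys \<Rightarrow> ('uh \<times> 'u) set \<Rightarrow> ('x \<times> 'xh) set \<Rightarrow>
     ('uh \<times> 'y1) set \<Rightarrow> ('x \<times> 'y2) set \<Rightarrow> ('xh \<times> 'x2) set \<Rightarrow> ('xc, 'x2, 'vc, 'uh) sys \<Rightarrow>
     (nat \<rightharpoonup> 'y1 \<times> 'y2) set" where
  "perturbed_loop_behavior Y1 Y2 S1 P1 P2 P3 P4 Q C =
     {pair_signal y1 y2 | y1 y2. \<exists>T. 1 \<le> T \<and> y1 \<in> signals T Y1 \<and> y2 \<in> signals T Y2 \<and>
        (\<exists>u x uc vc xc yc.
           solution S1 T u u x x \<and> solution C T uc vc xc yc \<and>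
           (\<forall>t\<in>interval T.
              the (u t) \<in> P1 `` {the (yc t)} \<and>
              the (uc t) \<in> Q `` (P2 `` {the (x t)}) \<and>
              the (y1 t) \<in> P3 `` {the (yc t)} \<and>
              the (y2 t) \<in> P4 `` {the (x t)}) \<and>
           (\<forall>n. T = enat n \<longrightarrow>
              trans_map S1 `` {(the (x (n - 1)), the (u (n - 1)))} = {} \<or>
              trans_map C `` {(the (xc (n - 1)), the (vc (n - 1)))} = {}))}"

definition robust_spec ::
  "'uh set \<Rightarrow> 'x set \<Rightarrow> 'y1 set \<Rightarrow> 'y2 set \<Rightarrow> ('uh \<times> 'y1) set \<Rightarrow> ('x \<times> 'y2) set \<Rightarrow>
     (nat \<rightharpoonup> 'y1 \<times> 'y2) set \<Rightarrow> (nat \<rightharpoonup> 'uh \<times> 'x) set \<Rightarrow> bool" where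
  "robust_spec Uh X1 Y1 Y2 P3 P4 \<Sigma>1 \<Sigma>h \<longleftrightarrow>
     (\<forall>T\<ge>1. \<forall>yc\<in>signals T Uh. \<forall>x\<in>signals T X1. \<forall>y1\<in>signals T Y1. \<forall>y2\<in>signals T Y2.
        pair_signal yc x \<in> \<Sigma>h \<and>
        (\<forall>t\<in>interval T. the (y1 t) \<in> P3 `` {the (yc t)} \<and> the (y2 t) \<in> P4 `` {the (x t)}) \<longrightarrow>
        pair_signal y1 y2 \<in> \<Sigma>1)"

definition enabled :: "('x, 'u, 'u, 'x) sys \<Rightarrow> 'x \<Rightarrow> 'u set" where
  "enabled S x = {u \<in> inputs S. trans_map S `` {(x, u)} \<noteq> {}}"

definition feedback_refinement ::
  "('x1, 'u, 'u, 'x1) sys \<Rightarrow> ('x2, 'u, 'u, 'x2) sys \<Rightarrow> ('x1 \<times> 'x2) set \<Rightarrow> bool" where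
  "feedback_refinement S1 S2 R \<longleftrightarrow>
     simple_system S1 \<and> simple_system S2 \<and> inputs S2 \<subseteq> inputs S1 \<and>
     set_valued (states S1) (states S2) R \<and> strict_on (states S1) R \<and>
     (\<forall>(x1, x2)\<in>R.
        enabled S2 x2 \<subseteq> enabled S1 x1 \<and>
        (\<forall>u\<in>enabled S2 x2. R `` (trans_map S1 `` {(x1, u)}) \<subseteq> trans_map S2 `` {(x2, u)}))"

definition abstract_spec ::
  "('x1, 'u, 'u, 'x1) sys \<Rightarrow> ('x2, 'u, 'u, 'x2) sys \<Rightarrow> ('x1 \<times> 'x2) set \<Rightarrow>
     (nat \<rightharpoonup> 'u \<times> 'x1) set \<Rightarrow> (nat \<rightharpoonup> 'u \<times> 'x2) set \<Rightarrow> bool" where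
  "abstract_spec S1 S2 R \<Sigma>1 \<Sigma>2 \<longleftrightarrow>
     is_spec (inputs S2 \<times> states S2) \<Sigma>2 \<and>
     (\<forall>T\<ge>1. \<forall>u\<in>signals T (inputs S2). \<forall>x2\<in>signals T (states S2). \<forall>x1\<in>signals T (states S1).
        pair_signal u x2 \<in> \<Sigma>2 \<and> (\<forall>t\<in>interval T. (the (x1 t), the (x2 t)) \<in> R) \<longrightarrow>
        pair_signal u x1 \<in> \<Sigma>1)"

definition refined_problem ::
  "('x1, 'u, 'u, 'x1) sys \<Rightarrow> (nat \<rightharpoonup> 'u \<times> 'x1) set \<Rightarrow> ('x1 \<times> 'x2) set \<Rightarrow>
     ('x2, 'u, 'u, 'x2) sys \<Rightarrow> (nat \<rightharpoonup> 'u \<times> 'x2) set \<Rightarrow> bool" where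
  "refined_problem S1 \<Sigma>1 R S2 \<Sigma>2 \<longleftrightarrow>
     feedback_refinement S1 S2 R \<and> abstract_spec S1 S2 R \<Sigma>1 \<Sigma>2"

text \<open>The simple system with transition map \<open>F(x, u) = F1(x, P1(u))\<close> on the inputs \<open>Uh\<close>.\<close>

definition perturbed_system ::
  "('x, 'u, 'u, 'x) sys \<Rightarrow> 'uh set \<Rightarrow> ('uh \<times> 'u) set \<Rightarrow> ('x, 'uh, 'uh, 'x) sys" where
  "perturbed_system S1 Uh P1 =
     \<lparr> states = states S1,
       inits = states S1,
       inputs = Uh,
       internals = Uh,
       outputs = states S1,
       trans_map = {((x, u), x'). x \<in> states S1 \<and> u \<in> Uh \<and>
          x' \<in> trans_map S1 `` ({x} \<times> P1 `` {u})},
       out_map = Id_on (states S1 \<times> Uh) \<rparr>"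

lemma simple_system_perturbed_system:
  assumes "simple_system S1" "Uh \<noteq> {}"
  shows "simple_system (perturbed_system S1 Uh P1)"
  using assms
  by (auto simp: simple_system_def system_def perturbed_system_def set_valued_def strict_on_def)

lemma system_closed_loop:
  assumes "system S1" "system S2" "feedback_composable S1 S2"
  shows "system (closed_loop S1 S2)"
proof -
  have "strict_on (states (closed_loop S1 S2) \<times> inputs (closed_loop S1 S2))
          (out_map (closed_loop S1 S2))"
    unfolding strict_on_def
  proof
    fix a assume "a \<in> states (closed_loop S1 S2) \<times> inputs (closed_loop S1 S2)"
    then obtain x1 x2 where a: "a = ((x1, x2), 0)" "x1 \<in> states S1" "x2 \<in> states S2"
      by (auto simp: closed_loop_def)
    obtain u0 where u0: "u0 \<in> inputs S2" using assms(2) by (auto simp: system_def)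
    have "out_map S2 `` {(x2, u0)} \<noteq> {}"
      using assms(2) a u0 unfolding system_def strict_on_def by blast
    then obtain y2 v0 where h2: "(y2, v0) \<in> out_map S2 `` {(x2, u0)}" by auto
    then have "y2 \<in> inputs S1"
      using assms(2,3) unfolding system_def set_valued_def feedback_composable_def by blast
    then have "out_map S1 `` {(x1, y2)} \<noteq> {}"
      using assms(1) a unfolding system_def strict_on_def by blast
    then obtain y1 v1 where h1: "(y1, v1) \<in> out_map S1 `` {(x1, y2)}" by auto
    then have "y1 \<in> inputs S2"
      using assms(1,3) unfolding system_def set_valued_def feedback_composable_def by blast
    then obtain v2 where "(y2, v2) \<in> out_map S2 `` {(x2, y1)}"
      using assms(3) h2 u0 a unfolding feedback_composable_def moore_def by blast
    with h1 have "(a, ((y1, y2), (v1, v2))) \<in> out_map (closed_loop S1 S2)"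
      by (simp add: closed_loop_def a(1))
    then show "out_map (closed_loop S1 S2) `` {a} \<noteq> {}" by blast
  qed
  then show ?thesis
    using assms(1,2)
    unfolding system_def set_valued_def closed_loop_def by auto
qed

end

theory Submission
  imports Defs
begin

text \<open>
  The idea is to push a run of the perturbed loop up to the abstraction, where the controller is
  known to be correct, and to bring its correctness back down.

  Let \<open>x\<close> be the plant state and \<open>uc\<close>, \<open>yc\<close> the input and output of the controller in a run of the
  perturbed loop. Absorbing the actuator perturbation \<open>P1\<close> into the plant turns \<open>(yc, x)\<close> into a
  run of \<open>perturbed_system S1 Uh P1\<close> (\<open>solution_perturbed_system\<close>), and absorbing the measurement
  perturbation into the quantizer makes \<open>uc\<close> a selection of the relation \<open>P2 O Q\<close> along \<open>x\<close>. As
  \<open>P2 O Q\<close> is a feedback refinement relation, \<open>uc\<close> is then itself a state trajectory of \<open>S2\<close>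
  driven by \<open>yc\<close>, so that \<open>(yc, uc)\<close> is generated by the closed loop of \<open>C\<close> and \<open>S2\<close>
  (\<open>solution_closed_loop\<close>). The run is maximal there: the strict plant never blocks, hence a
  finite run of the perturbed loop can end only because the controller blocks, and that also stops
  the abstract loop. Therefore \<open>(yc, uc)\<close> satisfies \<open>\<Sigma>2\<close>, whence \<open>(yc, x)\<close> satisfies \<open>\<Sigma>h\<close> by the
  definition of an abstract specification, and the perturbed outputs satisfy \<open>\<Sigma>1\<close> by robustness.
\<close>

lemma signals_value:
  assumes "f \<in> signals T A" "t \<in> interval T"
  shows "f t = Some (the (f t))" and "the (f t) \<in> A"
proof -
  have "t \<in> dom f" using assms by (simp add: signals_def)
  then show "f t = Some (the (f t))" by auto
  then show "the (f t) \<in> A"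
    using assms(1) ranI[of f t] by (force simp: signals_def)
qed

lemma pair_signal_value:
  assumes "f \<in> signals T A" "g \<in> signals T B" "t \<in> interval T"
  shows "the (pair_signal f g t) = (the (f t), the (g t))"
  using signals_value(1)[OF assms(1,3)] signals_value(1)[OF assms(2,3)]
  by (metis (no_types, lifting) case_prod_conv option.case(2) option.sel pair_signal_def)

lemma pair_signal_in_signals:
  assumes "f \<in> signals T A" "g \<in> signals T B"
  shows "pair_signal f g \<in> signals T (A \<times> B)"
proof -
  have "dom (pair_signal f g) = dom f \<inter> dom g"
    by (auto simp: pair_signal_def dom_def split: option.splits)
  moreover have "ran (pair_signal f g) \<subseteq> ran f \<times> ran g"
    by (auto simp: pair_signal_def ran_def split: option.splits)
  ultimately show ?thesis using assms by (auto simp: signals_def)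
qed

lemma interval_pred:
  assumes "t \<in> interval (T - 1)"
  shows "t \<in> interval T" and "t + 1 \<in> interval T"
  using assms by (cases T; auto simp: interval_def one_enat_def)+

lemma zero_in_interval: "1 \<le> T \<Longrightarrow> 0 \<in> interval T"
  by (cases T) (auto simp: interval_def one_enat_def zero_enat_def)

lemma last_in_interval: "1 \<le> enat n \<Longrightarrow> n - 1 \<in> interval (enat n)"
  by (auto simp: interval_def one_enat_def)

lemma solution_perturbed_system:
  assumes sol: "solution S1 T u u x x"
    and w: "w \<in> signals T Uh"
    and act: "\<And>t. t \<in> interval T \<Longrightarrow> the (u t) \<in> P1 `` {the (w t)}"
  shows "solution (perturbed_system S1 Uh P1) T w w x x"
proof -
  have x: "x \<in> signals T (states S1)" and T: "1 \<le> T" using sol by (auto simp: solution_def)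
  have "the (x (t + 1)) \<in> trans_map (perturbed_system S1 Uh P1) `` {(the (x t), the (w t))}"
    if t: "t \<in> interval (T - 1)" for t
    using sol t act[OF interval_pred(1)[OF t]] signals_value(2)[OF x interval_pred(1)[OF t]]
      signals_value(2)[OF w interval_pred(1)[OF t]]
    unfolding solution_def perturbed_system_def by auto
  then show ?thesis
    using T x w signals_value(2)[OF x] signals_value(2)[OF w] zero_in_interval[OF T]
    unfolding solution_def by (auto simp: perturbed_system_def)
qed

text \<open>
  A feedback refinement relation constrains successors only under inputs that are enabled in the
  abstraction, so it has to be seen that the controller applies no others. This is where
  composability enters: as long as the run goes on, the controller has a successor, and
  composability says that it would have none if the abstraction were blocked.
\<close>

lemma solution_closed_loop:
  assumes ref: "feedback_refinement S1 S2 R"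
    and comp: "feedback_composable C S2"
    and sol: "solution S1 T u u x x"
    and solC: "solution C T z v xc u"
    and rel: "\<And>t. t \<in> interval T \<Longrightarrow> (the (x t), the (z t)) \<in> R"
  shows "solution (closed_loop C S2) T (\<lambda>t. if t \<in> interval T then Some 0 else None)
    (pair_signal v u) (pair_signal xc z) (pair_signal u z)"
proof -
  have T: "1 \<le> T" and xc: "xc \<in> signals T (states C)" and v: "v \<in> signals T (internals C)"
    and uC: "u \<in> signals T (outputs C)" and zC: "z \<in> signals T (inputs C)"
    using solC by (auto simp: solution_def)
  have S2: "simple_system S2" using ref by (simp add: feedback_refinement_def)
  have "the (z t) \<in> states S2" if "t \<in> interval T" for t
    using rel[OF that] ref by (auto simp: feedback_refinement_def set_valued_def)
  then have z: "z \<in> signals T (states S2)"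
    using zC by (fastforce simp: signals_def ran_def dom_def set_eq_iff)
  have u: "u \<in> signals T (inputs S2)"
    using uC comp by (auto simp: signals_def feedback_composable_def)
  have outC: "(the (u t), the (v t)) \<in> out_map C `` {(the (xc t), the (z t))}"
    if "t \<in> interval T" for t using solC that by (simp add: solution_def)
  have out2: "(the (z t), the (u t)) \<in> out_map S2 `` {(the (z t), the (u t))}"
    if "t \<in> interval T" for t
    using S2 signals_value(2)[OF z that] signals_value(2)[OF u that]
    by (simp add: simple_system_def)
  have step: "the (xc (t + 1)) \<in> trans_map C `` {(the (xc t), the (v t))} \<and>
      the (z (t + 1)) \<in> trans_map S2 `` {(the (z t), the (u t))}"
    if t: "t \<in> interval (T - 1)" for t
  proof
    note tT = interval_pred[OF t]
    show C: "the (xc (t + 1)) \<in> trans_map C `` {(the (xc t), the (v t))}"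
      using solC t by (simp add: solution_def)
    then have "trans_map S2 `` {(the (z t), the (u t))} \<noteq> {}"
      using comp outC[OF tT(1)] out2[OF tT(1)] unfolding feedback_composable_def by blast
    then have "the (u t) \<in> enabled S2 (the (z t))"
      using signals_value(2)[OF u tT(1)] by (simp add: enabled_def)
    moreover have "the (x (t + 1)) \<in> trans_map S1 `` {(the (x t), the (u t))}"
      using sol t by (simp add: solution_def)
    ultimately show "the (z (t + 1)) \<in> trans_map S2 `` {(the (z t), the (u t))}"
      using ref rel[OF tT(1)] rel[OF tT(2)] unfolding feedback_refinement_def by blast
  qed
  have init: "the (xc 0) \<in> inits C" "the (z 0) \<in> inits S2"
    using solC S2 signals_value(2)[OF z zero_in_interval[OF T]]
    by (auto simp: solution_def simple_system_def)
  have sig: "pair_signal v u \<in> signals T (internals C \<times> internals S2)"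
    "pair_signal xc z \<in> signals T (states C \<times> states S2)"
    "pair_signal u z \<in> signals T (outputs C \<times> outputs S2)"
    using pair_signal_in_signals[OF v u] pair_signal_in_signals[OF xc z]
      pair_signal_in_signals[OF uC z] S2
    by (auto simp: simple_system_def)
  have zero: "(\<lambda>t. if t \<in> interval T then Some 0 else None) \<in> signals T {0::nat}"
    by (auto simp: signals_def dom_def ran_def)
  show ?thesis
    unfolding solution_def
  proof (intro conjI ballI)
    show "1 \<le> T" by (rule T)
    show "the (pair_signal xc z 0) \<in> inits (closed_loop C S2)"
      using init pair_signal_value[OF xc z zero_in_interval[OF T]] by (simp add: closed_loop_def)
  next
    fix t assume t: "t \<in> interval (T - 1)"
    note tT = interval_pred[OF t]
    show "the (pair_signal xc z (t + 1))
        \<in> trans_map (closed_loop C S2) `` {(the (pair_signal xc z t), the (pair_signal v u t))}"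
      using step[OF t] unfolding pair_signal_value[OF xc z tT(2)] pair_signal_value[OF xc z tT(1)]
        pair_signal_value[OF v u tT(1)]
      by (simp add: closed_loop_def)
  next
    fix t assume t: "t \<in> interval T"
    show "(the (pair_signal u z t), the (pair_signal v u t)) \<in> out_map (closed_loop C S2) ``
        {(the (pair_signal xc z t), the (if t \<in> interval T then Some 0 else None))}"
      using outC[OF t] out2[OF t] t
      unfolding pair_signal_value[OF xc z t] pair_signal_value[OF v u t] pair_signal_value[OF u z t]
      by (simp add: closed_loop_def)
  qed (use sig zero in \<open>simp_all add: closed_loop_def\<close>)
qed

theorem mainTheorem5:
  fixes S1 :: "('x, 'u, 'u, 'x) sys"
    and C :: "('xc, 'x2, 'vc, 'uh) sys"
    and S2 :: "('x2, 'uh, 'uh, 'x2) sys"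
    and Uh :: "'uh set" and Xh :: "'xh set" and X2 :: "'x2 set"
    and Y1 :: "'y1 set" and Y2 :: "'y2 set"
    and P1 :: "('uh \<times> 'u) set" and P2 :: "('x \<times> 'xh) set"
    and P3 :: "('uh \<times> 'y1) set" and P4 :: "('x \<times> 'y2) set"
    and Q :: "('xh \<times> 'x2) set"
    and \<Sigma>1 :: "(nat \<rightharpoonup> 'y1 \<times> 'y2) set"
    and \<Sigma>h :: "(nat \<rightharpoonup> 'uh \<times> 'x) set"
    and \<Sigma>2 :: "(nat \<rightharpoonup> 'uh \<times> 'x2) set"
  assumes "simple_system S1"
    and "strict_on (states S1 \<times> inputs S1) (trans_map S1)"
    and "perturbation_map Uh (inputs S1) P1"
    and "perturbation_map (states S1) Xh P2"
    and "perturbation_map Uh Y1 P3"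
    and "perturbation_map (states S1) Y2 P4"
    and "set_valued Xh X2 Q" and "strict_on Xh Q"
    and "system C" and "inputs C = X2" and "outputs C = Uh"
    and "is_spec (Y1 \<times> Y2) \<Sigma>1"
    and "is_spec (Uh \<times> states S1) \<Sigma>h"
    and "robust_spec Uh (states S1) Y1 Y2 P3 P4 \<Sigma>1 \<Sigma>h"
    and "simple_system S2" and "states S2 = X2"
    and "refined_problem (perturbed_system S1 Uh P1) \<Sigma>h (P2 O Q) S2 \<Sigma>2"
    and "solves C S2 \<Sigma>2"
  shows "perturbed_loop_behavior Y1 Y2 S1 P1 P2 P3 P4 Q C \<subseteq> \<Sigma>1"
proof
  fix y assume "y \<in> perturbed_loop_behavior Y1 Y2 S1 P1 P2 P3 P4 Q C"
  then obtain y1 y2 T u x uc vc xc yc where y: "y = pair_signal y1 y2" and T: "1 \<le> T"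
    and y1: "y1 \<in> signals T Y1" and y2: "y2 \<in> signals T Y2"
    and sol: "solution S1 T u u x x" and solC: "solution C T uc vc xc yc"
    and pert: "\<And>t. t \<in> interval T \<Longrightarrow> the (u t) \<in> P1 `` {the (yc t)} \<and>
              the (uc t) \<in> Q `` (P2 `` {the (x t)}) \<and>
              the (y1 t) \<in> P3 `` {the (yc t)} \<and> the (y2 t) \<in> P4 `` {the (x t)}"
    and fin: "\<And>n. T = enat n \<Longrightarrow>
              trans_map S1 `` {(the (x (n - 1)), the (u (n - 1)))} = {} \<or>
              trans_map C `` {(the (xc (n - 1)), the (vc (n - 1)))} = {}"
    unfolding perturbed_loop_behavior_def by blast
  let ?Sh = "perturbed_system S1 Uh P1"
  have ref: "feedback_refinement ?Sh S2 (P2 O Q)" and abs: "abstract_spec ?Sh S2 (P2 O Q) \<Sigma>h \<Sigma>2"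
    using assms(17) by (auto simp: refined_problem_def)
  have comp: "feedback_composable C S2" and solves: "closed_loop_behavior C S2 \<subseteq> \<Sigma>2"
    using assms(18) by (auto simp: solves_def)
  have x: "x \<in> signals T (states S1)" and u: "u \<in> signals T (inputs S1)"
    using sol by (auto simp: solution_def)
  have yc: "yc \<in> signals T Uh" and uc: "uc \<in> signals T (states S2)"
    and vc: "vc \<in> signals T (internals C)" and xc: "xc \<in> signals T (states C)"
    using solC assms(10,11,16) by (auto simp: solution_def)
  have yc2: "yc \<in> signals T (inputs S2)"
    using yc comp assms(11) by (auto simp: signals_def feedback_composable_def)
  have rel: "(the (x t), the (uc t)) \<in> P2 O Q" if "t \<in> interval T" for t
    using pert[OF that] by blast
  have loop: "solution (closed_loop C S2) T (\<lambda>t. if t \<in> interval T then Some 0 else None)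
      (pair_signal vc yc) (pair_signal xc uc) (pair_signal yc uc)"
    using solution_closed_loop[OF ref comp solution_perturbed_system[OF sol yc] solC rel]
      pert by blast
  have "trans_map (closed_loop C S2) ``
      {(the (pair_signal xc uc (n - 1)), the (pair_signal vc yc (n - 1)))} = {}"
    if n: "T = enat n" for n
  proof -
    have l: "n - 1 \<in> interval T" using last_in_interval T n by simp
    have "trans_map S1 `` {(the (x (n - 1)), the (u (n - 1)))} \<noteq> {}"
      using assms(2) signals_value(2)[OF x l] signals_value(2)[OF u l]
      by (simp add: strict_on_def)
    then have "trans_map C `` {(the (xc (n - 1)), the (vc (n - 1)))} = {}" using fin[OF n] by blast
    then show ?thesis
      unfolding pair_signal_value[OF xc uc l] pair_signal_value[OF vc yc l]
      by (auto simp: closed_loop_def)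
  qed
  with loop have "pair_signal yc uc \<in> closed_loop_behavior C S2"
    unfolding closed_loop_behavior_def behavior_def by force
  then have "pair_signal yc uc \<in> \<Sigma>2" using solves by blast
  then have "pair_signal yc x \<in> \<Sigma>h"
    using abs T yc2 uc x rel
    unfolding abstract_spec_def perturbed_system_def sys.simps by blast
  then show "y \<in> \<Sigma>1"
    using assms(14) T yc x y1 y2 pert unfolding robust_spec_def y by blast
qed

end
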